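(* Every tree $T$ satisfies $\mathrm{sfw}(T)\le 4$.
   Context: All graphs are finite, simple and undirected. Split-free cable expressions. A cable is a nonempty set of vertices treated as one indivisible live unit. A split-free cable expression is a typed term; a term of type $p\to q$ receives $p$ ordered live cables and returns $q$ ordered live cables, and its cable rank is $\mathrm{cr}(p\to q)=p+q$. The generators are: $e:1\to1$ (keep one cable unchanged); $\nu_S:0\to1$ (birth a fresh nonempty vertex set $S$ as one cable); $\kappa:1\to0$ (close, i.e. remove, one cable); $\varphi:2\to1$ (fold two cables into their union); $B:2\to2$ (add all edges between the two cables, which both remain live); $K:1\to1$ (add all internal edges of the cable). Terms are combined by serial composition: if $s:p\to q$ and $t:q\to r$ then $s\circ t:p\to r$, where $s$ is performed before $t$; and by parallel product: if $s:p\to q$ and $t:p'\to q'$ then $s\mathbin{\Box}t:p+p'\to q+q'$, which executes the two terms on disjoint vertex sets and concatenates their output cables. Cable permutations are structural reindexings of the ordered interface; they create no vertices or edges and do not change cable rank. The value of a closed expression $t:0\to0$ is the graph on the born vertices whose edges are those added by its block ($B$) and clique ($K$) operations (edge additions use set union). A closed expression is legal for a graph $G$ if every vertex is born exactly once, every added edge belongs to $G$, and the final graph is $G$. The width of an expression is the largest cable rank of a subterm occurrence, where the rank of a subterm is that of its own interface type in the parse tree (so identity wires placed in parallel with a subterm are counted only in the enclosing subterm, not in the subterm itself). $\mathrm{sfw}(G)$ is the minimum width of a legal closed expression for $G$ (value $0$ for the empty graph). *)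

theory Defs
  imports
    "HOL-Library.Extended_Nat"
    "HOL-Library.Multiset"
    "HOL-Combinatorics.Permutations"
begin

section \<open>Finite simple graphs and trees\<close>

type_synonym 'a ugraph = "'a set \<times> 'a set set"

abbreviation verts :: "'a ugraph \<Rightarrow> 'a set" where
  "verts G \<equiv> fst G"

abbreviation edges :: "'a ugraph \<Rightarrow> 'a set set" where
  "edges G \<equiv> snd G"

definition simple_graph :: "'a ugraph \<Rightarrow> bool" where
  "simple_graph G \<longleftrightarrow> finite (verts G) \<and> (\<forall>e\<in>edges G. e \<subseteq> verts G \<and> card e = 2)"

definition connected_graph :: "'a ugraph \<Rightarrow> bool" where
  "connected_graph G \<longleftrightarrow> verts G \<noteq> {} \<and>
     (\<forall>u\<in>verts G. \<forall>v\<in>verts G. (u, v) \<in> {(x, y). {x, y} \<in> edges G}\<^sup>*)"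

definition is_cycle :: "'a ugraph \<Rightarrow> 'a list \<Rightarrow> bool" where
  "is_cycle G vs \<longleftrightarrow> 3 \<le> length vs \<and> distinct vs \<and>
     (\<forall>i<length vs. {vs ! i, vs ! (Suc i mod length vs)} \<in> edges G)"

definition is_tree :: "'a ugraph \<Rightarrow> bool" where
  "is_tree G \<longleftrightarrow> simple_graph G \<and> connected_graph G \<and> (\<nexists>vs. is_cycle G vs)"


section \<open>Split-free cable expressions\<close>

text \<open>
  \<^term>\<open>Reindex \<sigma> t \<tau>\<close> is the term \<^term>\<open>t\<close> with its ordered input and output interfaces
  permuted. It has the same interface type as \<^term>\<open>t\<close>, so cable permutations
  do not change cable rank.
\<close>

datatype 'a cable_expr =
    Keep
  | Birth "'a set"
  | Close
  | Fold
  | Block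
  | Clique
  | Serial "'a cable_expr" "'a cable_expr"
  | Parallel "'a cable_expr" "'a cable_expr"
  | Reindex "nat \<Rightarrow> nat" "'a cable_expr" "nat \<Rightarrow> nat"

primrec ins :: "'a cable_expr \<Rightarrow> nat" where
  "ins Keep = 1"
| "ins (Birth S) = 0"
| "ins Close = 1"
| "ins Fold = 2"
| "ins Block = 2"
| "ins Clique = 1"
| "ins (Serial s t) = ins s"
| "ins (Parallel s t) = ins s + ins t"
| "ins (Reindex \<sigma> t \<tau>) = ins t"

primrec outs :: "'a cable_expr \<Rightarrow> nat" where
  "outs Keep = 1"
| "outs (Birth S) = 1"
| "outs Close = 0"
| "outs Fold = 1"
| "outs Block = 2"
| "outs Clique = 1"
| "outs (Serial s t) = outs t"
| "outs (Parallel s t) = outs s + outs t"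
| "outs (Reindex \<sigma> t \<tau>) = outs t"

primrec well_typed :: "'a cable_expr \<Rightarrow> bool" where
  "well_typed Keep \<longleftrightarrow> True"
| "well_typed (Birth S) \<longleftrightarrow> S \<noteq> {}"
| "well_typed Close \<longleftrightarrow> True"
| "well_typed Fold \<longleftrightarrow> True"
| "well_typed Block \<longleftrightarrow> True"
| "well_typed Clique \<longleftrightarrow> True"
| "well_typed (Serial s t) \<longleftrightarrow> well_typed s \<and> well_typed t \<and> outs s = ins t"
| "well_typed (Parallel s t) \<longleftrightarrow> well_typed s \<and> well_typed t"
| "well_typed (Reindex \<sigma> t \<tau>) \<longleftrightarrow>
     well_typed t \<and> \<sigma> permutes {..<ins t} \<and> \<tau> permutes {..<outs t}"

definition closed_expr :: "'a cable_expr \<Rightarrow> bool" where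
  "closed_expr t \<longleftrightarrow> well_typed t \<and> ins t = 0 \<and> outs t = 0"

definition cable_rank :: "'a cable_expr \<Rightarrow> nat" where
  "cable_rank t = ins t + outs t"

primrec subterms :: "'a cable_expr \<Rightarrow> 'a cable_expr set" where
  "subterms Keep = {Keep}"
| "subterms (Birth S) = {Birth S}"
| "subterms Close = {Close}"
| "subterms Fold = {Fold}"
| "subterms Block = {Block}"
| "subterms Clique = {Clique}"
| "subterms (Serial s t) = insert (Serial s t) (subterms s \<union> subterms t)"
| "subterms (Parallel s t) = insert (Parallel s t) (subterms s \<union> subterms t)"
| "subterms (Reindex \<sigma> t \<tau>) = insert (Reindex \<sigma> t \<tau>) (subterms t)"

definition width :: "'a cable_expr \<Rightarrow> nat" where
  "width t = Max (cable_rank ` subterms t)"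


section \<open>Semantics\<close>

text \<open>
  \<open>run t cs\<close> is the list of output cables of \<open>t\<close> on the input cables \<open>cs\<close>, and
  \<open>added t cs\<close> is the set of edges inserted on the way. Both are meaningful only if \<open>t\<close> is
  well typed and \<open>length cs = ins t\<close>.
\<close>

primrec run :: "'a cable_expr \<Rightarrow> 'a set list \<Rightarrow> 'a set list" where
  "run Keep cs = cs"
| "run (Birth S) cs = [S]"
| "run Close cs = []"
| "run Fold cs = [cs ! 0 \<union> cs ! 1]"
| "run Block cs = cs"
| "run Clique cs = cs"
| "run (Serial s t) cs = run t (run s cs)"
| "run (Parallel s t) cs = run s (take (ins s) cs) @ run t (drop (ins s) cs)"
| "run (Reindex \<sigma> t \<tau>) cs = permute_list \<tau> (run t (permute_list \<sigma> cs))"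

primrec added :: "'a cable_expr \<Rightarrow> 'a set list \<Rightarrow> 'a set set" where
  "added Keep cs = {}"
| "added (Birth S) cs = {}"
| "added Close cs = {}"
| "added Fold cs = {}"
| "added Block cs = {{u, v} | u v. u \<in> cs ! 0 \<and> v \<in> cs ! 1}"
| "added Clique cs = {{u, v} | u v. u \<in> cs ! 0 \<and> v \<in> cs ! 0 \<and> u \<noteq> v}"
| "added (Serial s t) cs = added s cs \<union> added t (run s cs)"
| "added (Parallel s t) cs = added s (take (ins s) cs) \<union> added t (drop (ins s) cs)"
| "added (Reindex \<sigma> t \<tau>) cs = added t (permute_list \<sigma> cs)"

primrec births :: "'a cable_expr \<Rightarrow> 'a set multiset" where
  "births Keep = {#}"
| "births (Birth S) = {#S#}"
| "births Close = {#}"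
| "births Fold = {#}"
| "births Block = {#}"
| "births Clique = {#}"
| "births (Serial s t) = births s + births t"
| "births (Parallel s t) = births s + births t"
| "births (Reindex \<sigma> t \<tau>) = births t"

definition expr_value :: "'a cable_expr \<Rightarrow> 'a ugraph" where
  "expr_value t = (\<Union> (set_mset (births t)), added t [])"

text \<open>
  The requirement that each vertex is born exactly once makes all simultaneously live cables
  pairwise disjoint. In particular, both factors of a parallel product act on disjoint vertex
  sets and \<^const>\<open>Block\<close> never produces a loop.
\<close>

definition legal :: "'a ugraph \<Rightarrow> 'a cable_expr \<Rightarrow> bool" where
  "legal G t \<longleftrightarrow> closed_expr t \<and>
     (\<forall>v\<in>verts G. size (filter_mset (\<lambda>S. v \<in> S) (births t)) = 1) \<and>
     added t [] \<subseteq> edges G \<and>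
     expr_value t = G"

text \<open>
  The codomain is \<^typ>\<open>enat\<close>, so that a graph without a legal expression would have width
  \<open>\<infinity>\<close>; otherwise the infimum is attained. The empty graph has no legal
  expression because \<^const>\<open>Birth\<close> takes nonempty sets, hence the separate case.
\<close>

definition sfw :: "'a ugraph \<Rightarrow> enat" where
  "sfw G = (if verts G = {} then 0 else (INF t\<in>{t. legal G t}. enat (width t)))"

end

theory Submission
  imports Defs
begin

text \<open>
  A tree rooted at \<open>r\<close> is realised by a term of type \<open>1 \<rightarrow> 1\<close> that receives the cable \<open>{r}\<close>,
  builds everything else while \<open>{r}\<close> stays live, and returns \<open>{r}\<close>. To hang a second rooted
  tree with root \<open>c\<close> below \<open>r\<close>, one births \<open>{c}\<close>, runs the term of that tree next to an
  identity wire (interface \<open>2 \<rightarrow> 2\<close>), blocks the two cables and closes \<open>{c}\<close>. No interface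
  exceeds rank 4, because parallel wires are not counted inside the subterm.
\<close>

inductive rooted_tree :: "'a \<Rightarrow> 'a set \<Rightarrow> 'a set set \<Rightarrow> bool" where
  single: "rooted_tree r {r} {}"
| join: "\<lbrakk>rooted_tree r V E; rooted_tree c W F; V \<inter> W = {}\<rbrakk>
    \<Longrightarrow> rooted_tree r (V \<union> W) (insert {r, c} (E \<union> F))"

lemma rooted_tree_finite: "rooted_tree r V E \<Longrightarrow> finite V"
  by (induction rule: rooted_tree.induct) auto

lemma rooted_tree_root: "rooted_tree r V E \<Longrightarrow> r \<in> V"
  by (induction rule: rooted_tree.induct) auto

text \<open>The rule \<open>join\<close> only attaches at the root, while growing a tree vertex by
  vertex needs a leaf at an arbitrary \<open>u\<close>. Induction pushes the leaf down into
  whichever of the two parts contains \<open>u\<close>, until that part is a single vertex.\<close>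

lemma rooted_tree_add_leaf:
  assumes "rooted_tree r V E" "u \<in> V" "v \<notin> V"
  shows "rooted_tree r (insert v V) (insert {u, v} E)"
  using assms
proof (induction arbitrary: u v rule: rooted_tree.induct)
  case (single r)
  then show ?case
    using rooted_tree.join[OF rooted_tree.single[of r] rooted_tree.single[of v]]
    by (simp add: insert_commute)
next
  case (join r V E c W F)
  show ?case
  proof (cases "u \<in> V")
    case True
    have "rooted_tree r (insert v V \<union> W) (insert {r, c} (insert {u, v} E \<union> F))"
      using join True by (intro rooted_tree.join) auto
    then show ?thesis by (simp add: insert_commute)
  next
    case False
    have "rooted_tree r (V \<union> insert v W) (insert {r, c} (E \<union> insert {u, v} F))"
      using join False by (intro rooted_tree.join) auto
    then show ?thesis by (simp add: insert_commute)
  qed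
qed

text \<open>Between the two parts of a \<open>join\<close>, a path runs to the root of its own part,
  crosses the edge \<open>{r, c}\<close> and continues in the other part; disjointness of the parts
  keeps its vertices distinct. These paths later serve to exhibit cycles.\<close>

lemma rooted_tree_path:
  assumes "rooted_tree r V E" "x \<in> V" "y \<in> V"
  shows "\<exists>vs. vs \<noteq> [] \<and> hd vs = x \<and> last vs = y \<and> distinct vs \<and> set vs \<subseteq> V \<and>
    successively (\<lambda>a b. {a, b} \<in> E) vs"
  using assms
proof (induction arbitrary: x y rule: rooted_tree.induct)
  case (single r)
  then show ?case by (intro exI[of _ "[r]"]) auto
next
  case (join r V E c W F)
  let ?E = "insert {r, c} (E \<union> F)"
  have mono: "successively (\<lambda>a b. {a, b} \<in> ?E) vs"
    if "successively (\<lambda>a b. {a, b} \<in> E) vs \<or> successively (\<lambda>a b. {a, b} \<in> F) vs" for vs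
    using that by (auto elim: successively_mono)
  have "r \<in> V" "c \<in> W" by (rule rooted_tree_root[OF join.hyps(1)], rule rooted_tree_root[OF join.hyps(2)])
  consider "x \<in> V" "y \<in> V" | "x \<in> W" "y \<in> W" | "x \<in> V" "y \<in> W" | "x \<in> W" "y \<in> V"
    using join.prems by auto
  then show ?case
  proof cases
    case 1
    from join.IH(1)[OF this] show ?thesis using mono by blast
  next
    case 2
    from join.IH(2)[OF this] show ?thesis using mono by blast
  next
    case 3
    from join.IH(1)[OF 3(1) \<open>r \<in> V\<close>] obtain ps where ps: "ps \<noteq> []" "hd ps = x" "last ps = r"
      "distinct ps" "set ps \<subseteq> V" "successively (\<lambda>a b. {a, b} \<in> E) ps" by blast
    from join.IH(2)[OF \<open>c \<in> W\<close> 3(2)] obtain qs where qs: "qs \<noteq> []" "hd qs = c" "last qs = y"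
      "distinct qs" "set qs \<subseteq> W" "successively (\<lambda>a b. {a, b} \<in> F) qs" by blast
    show ?thesis
      using ps qs \<open>V \<inter> W = {}\<close> mono[of ps] mono[of qs]
      by (intro exI[of _ "ps @ qs"]) (auto simp: successively_append_iff)
  next
    case 4
    from join.IH(2)[OF 4(1) \<open>c \<in> W\<close>] obtain ps where ps: "ps \<noteq> []" "hd ps = x" "last ps = c"
      "distinct ps" "set ps \<subseteq> W" "successively (\<lambda>a b. {a, b} \<in> F) ps" by blast
    from join.IH(1)[OF \<open>r \<in> V\<close> 4(2)] obtain qs where qs: "qs \<noteq> []" "hd qs = r" "last qs = y"
      "distinct qs" "set qs \<subseteq> V" "successively (\<lambda>a b. {a, b} \<in> E) qs" by blast
    show ?thesis
      using ps qs \<open>V \<inter> W = {}\<close> mono[of ps] mono[of qs]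
      by (intro exI[of _ "ps @ qs"]) (auto simp: successively_append_iff insert_commute)
  qed
qed

text \<open>Distinct ends force at least two vertices on the path, so together with \<open>v\<close>
  the cycle has the required length of at least 3.\<close>

lemma is_cycle_close_path:
  assumes path: "vs \<noteq> []" "distinct vs" "successively (\<lambda>a b. {a, b} \<in> edges G) vs"
    and ends: "hd vs \<noteq> last vs" "{hd vs, v} \<in> edges G" "{last vs, v} \<in> edges G"
    and "v \<notin> set vs"
  shows "is_cycle G (vs @ [v])"
proof -
  have "2 \<le> length vs"
    using ends(1) path(1) by (cases vs; cases "tl vs") auto
  moreover have "{(vs @ [v]) ! i, (vs @ [v]) ! (Suc i mod length (vs @ [v]))} \<in> edges G"
    if "i < length (vs @ [v])" for i
  proof -
    \<comment> \<open>The three cases are an edge of the path, the edge from its last vertex to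
      \<open>v\<close>, and the edge from \<open>v\<close> back to the head, where the index modulo
      the length wraps to 0.\<close>
    have "Suc i < length vs \<or> Suc i = length vs \<or> i = length vs"
      using that by auto
    then consider "Suc i < length vs" | "Suc i = length vs" | "i = length vs" by blast
    then show ?thesis
    proof cases
      case 1
      then show ?thesis using path(3) by (auto simp: successively_conv_nth nth_append)
    next
      case 2
      then have "i = length vs - 1" by simp
      then show ?thesis using ends(3) path(1) 2 by (auto simp: nth_append last_conv_nth)
    next
      case 3
      then show ?thesis
        using ends(2) path(1) by (auto simp: nth_append hd_conv_nth insert_commute)
    qed
  qed
  ultimately show ?thesis
    using path assms(7) by (auto simp: is_cycle_def)
qed

lemma rtrancl_leaves_set:
  assumes "(x, y) \<in> R\<^sup>*" "x \<in> U" "y \<notin> U"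
  shows "\<exists>u v. (u, v) \<in> R \<and> u \<in> U \<and> v \<notin> U"
  using assms by (induction rule: rtrancl_induct) blast+

text \<open>Take a largest \<open>U\<close> whose induced subgraph is a rooted tree with root
  \<open>r\<close>. If \<open>U\<close> missed a vertex, connectedness would give an edge leaving
  \<open>U\<close>, and acyclicity would make its outer end a leaf over \<open>U\<close>, so
  \<open>U\<close> could be enlarged.\<close>

lemma is_tree_imp_rooted_tree:
  assumes T: "is_tree T" and r: "r \<in> verts T"
  shows "rooted_tree r (verts T) (edges T)"
proof -
  let ?P = "\<lambda>U. U \<subseteq> verts T \<and> rooted_tree r U {e \<in> edges T. e \<subseteq> U}"
  have fin: "finite (verts T)" and simple: "\<And>e. e \<in> edges T \<Longrightarrow> e \<subseteq> verts T \<and> card e = 2"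
    using T by (auto simp: is_tree_def simple_graph_def)
  have no_loops: "{e \<in> edges T. e \<subseteq> {r}} = {}"
  proof -
    have "card e \<noteq> 2" if "e \<subseteq> {r}" for e
      using card_mono[OF _ that] by auto
    then show ?thesis using simple by blast
  qed
  have start: "?P {r}" unfolding no_loops using r by (simp add: rooted_tree.single)
  have "\<forall>U. ?P U \<longrightarrow> card U < Suc (card (verts T))"
    using fin by (auto intro: card_mono simp: less_Suc_eq_le)
  from ex_has_greatest_nat[of ?P, OF start this]
  obtain U where U: "?P U" and max: "\<And>U'. ?P U' \<Longrightarrow> card U' \<le> card U"
    by blast
  have rt: "rooted_tree r U {e \<in> edges T. e \<subseteq> U}" using U by simp
  have "U = verts T"
  proof (rule ccontr)
    assume "U \<noteq> verts T"
    then obtain w where w: "w \<in> verts T" "w \<notin> U" using U by blast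
    have "(r, w) \<in> {(x, y). {x, y} \<in> edges T}\<^sup>*"
      using T r w(1) by (auto simp: is_tree_def connected_graph_def)
    from rtrancl_leaves_set[OF this rooted_tree_root[OF rt] w(2)]
    obtain u v where uv: "{u, v} \<in> edges T" "u \<in> U" "v \<notin> U" by blast
    \<comment> \<open>A second neighbour of \<open>v\<close> in \<open>U\<close> would be joined to
      \<open>u\<close> by a path inside \<open>U\<close>, which closes to a cycle through
      \<open>v\<close>.\<close>
    have unique: "x = u" if x: "x \<in> U" "{x, v} \<in> edges T" for x
    proof (rule ccontr)
      assume "x \<noteq> u"
      obtain vs where vs: "vs \<noteq> []" "hd vs = x" "last vs = u" "distinct vs" "set vs \<subseteq> U"
        "successively (\<lambda>a b. {a, b} \<in> {e \<in> edges T. e \<subseteq> U}) vs"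
        using rooted_tree_path[OF rt x(1) uv(2)] by blast
      have "successively (\<lambda>a b. {a, b} \<in> edges T) vs"
        using vs(6) by (rule successively_mono) auto
      then have "is_cycle T (vs @ [v])"
        using vs x uv \<open>x \<noteq> u\<close> by (intro is_cycle_close_path) auto
      then show False using T by (auto simp: is_tree_def)
    qed
    \<comment> \<open>\<open>?P\<close> demands all edges of \<open>T\<close> inside the vertex set,
      so \<open>{u, v}\<close> must be the only edge gained by adding \<open>v\<close>.\<close>
    have "e = {u, v}" if e: "e \<in> edges T" "e \<subseteq> insert v U" "\<not> e \<subseteq> U" for e
    proof -
      obtain a b where ab: "e = {a, b}" "a \<noteq> b"
        using simple[OF e(1)] by (auto simp: card_2_iff)
      then have "(a = v \<and> b \<in> U) \<or> (b = v \<and> a \<in> U)" using e by auto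
      then show ?thesis using unique e(1) ab(1) by (auto simp: insert_commute)
    qed
    then have "{e \<in> edges T. e \<subseteq> insert v U} = insert {u, v} {e \<in> edges T. e \<subseteq> U}"
      using uv by blast
    moreover have "v \<in> verts T" using simple[OF uv(1)] by simp
    ultimately have "?P (insert v U)"
      using rooted_tree_add_leaf[OF rt uv(2,3)] U by simp
    then have "card (insert v U) \<le> card U" by (rule max)
    then show False using uv(3) rooted_tree_finite[OF rt] by simp
  qed
  moreover have "{e \<in> edges T. e \<subseteq> verts T} = edges T" using simple by blast
  ultimately show ?thesis using rt by simp
qed

text \<open>
  The births are stated together with the root cable, which the term itself does not create.
\<close>

lemma rooted_tree_expr:
  assumes "rooted_tree r V E"
  shows "\<exists>t. well_typed t \<and> ins t = 1 \<and> outs t = 1 \<and> run t [{r}] = [{r}] \<and> added t [{r}] = E \<and>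
    add_mset {r} (births t) = image_mset (\<lambda>v. {v}) (mset_set V) \<and>
    (\<forall>s\<in>subterms t. cable_rank s \<le> 4)"
  using assms
proof (induction rule: rooted_tree.induct)
  case (single r)
  show ?case by (intro exI[of _ Keep]) (simp add: cable_rank_def)
next
  case (join r V E c W F)
  obtain t where t: "well_typed t" "ins t = 1" "outs t = 1" "run t [{r}] = [{r}]"
    "added t [{r}] = E" "add_mset {r} (births t) = image_mset (\<lambda>v. {v}) (mset_set V)"
    "\<forall>s\<in>subterms t. cable_rank s \<le> 4"
    using join.IH(1) by blast
  obtain s where s: "well_typed s" "ins s = 1" "outs s = 1" "run s [{c}] = [{c}]"
    "added s [{c}] = F" "add_mset {c} (births s) = image_mset (\<lambda>v. {v}) (mset_set W)"
    "\<forall>s'\<in>subterms s. cable_rank s' \<le> 4"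
    using join.IH(2) by blast
  \<comment> \<open>Among the subterms added here, only \<open>Parallel Keep s\<close> and
    \<open>Block\<close> reach rank 4; nesting the serial compositions to the right gives every
    remaining tail a single output, hence rank at most 3.\<close>
  let ?t = "Serial t (Serial (Parallel Keep (Birth {c}))
    (Serial (Parallel Keep s) (Serial Block (Parallel Keep Close))))"
  \<comment> \<open>\<open>Birth {c}\<close> supplies exactly the root cable missing from
    \<open>births s\<close>, so \<open>{r}\<close> is again the only one left to be born
    outside.\<close>
  have "add_mset {r} (births ?t) = add_mset {r} (births t) + add_mset {c} (births s)"
    by simp
  also have "\<dots> = image_mset (\<lambda>v. {v}) (mset_set (V \<union> W))"
    using t(6) s(6) join.hyps(3) rooted_tree_finite[OF join.hyps(1)] rooted_tree_finite[OF join.hyps(2)]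
    by (simp add: mset_set_Union)
  finally show ?case
    using t s by (intro exI[of _ ?t]) (auto simp: cable_rank_def)
qed

lemma finite_subterms: "finite (subterms t)"
  by (induction t) auto

lemma subterms_self: "t \<in> subterms t"
  by (cases t) auto

theorem theorem4p1:
  fixes T :: "'a ugraph"
  assumes "is_tree T"
  shows "sfw T \<le> 4"
proof -
  obtain r where r: "r \<in> verts T"
    using assms by (auto simp: is_tree_def connected_graph_def)
  have fin: "finite (verts T)"
    using assms by (simp add: is_tree_def simple_graph_def)
  obtain t where t: "well_typed t" "ins t = 1" "outs t = 1" "run t [{r}] = [{r}]"
    "added t [{r}] = edges T"
    "add_mset {r} (births t) = image_mset (\<lambda>v. {v}) (mset_set (verts T))"
    "\<forall>s\<in>subterms t. cable_rank s \<le> 4"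
    using rooted_tree_expr[OF is_tree_imp_rooted_tree[OF assms r]] by blast
  \<comment> \<open>Only the root cable is still to be born and closed; both ends of the term
    thereby become empty, and the new subterms have rank at most 1.\<close>
  define c where "c = Serial (Birth {r}) (Serial t Close)"
  have births: "births c = image_mset (\<lambda>v. {v}) (mset_set (verts T))"
    using t(6) by (simp add: c_def)
  have "size (filter_mset (\<lambda>S. v \<in> S) (births c)) = 1" if "v \<in> verts T" for v
  proof -
    \<comment> \<open>All born cables are singletons, one for each vertex, so exactly one of them
      contains \<open>v\<close>.\<close>
    have "filter_mset (\<lambda>S. v \<in> S) (births c) = image_mset (\<lambda>v. {v}) (mset_set {v})"
    proof -
      have "{x \<in> verts T. v = x} = {v}" using that by auto
      then show ?thesis
        using fin by (simp add: births filter_mset_image_mset filter_mset_mset_set)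
    qed
    then show ?thesis by simp
  qed
  moreover have "expr_value c = T"
    using t fin births by (simp add: expr_value_def c_def prod_eq_iff)
  ultimately have "legal T c"
    using t by (auto simp: legal_def closed_expr_def c_def)
  moreover have "width c \<le> 4"
  proof -
    have "\<forall>s\<in>subterms c. cable_rank s \<le> 4"
      using t by (auto simp: c_def cable_rank_def)
    then show ?thesis
      using finite_subterms[of c] subterms_self[of c] by (auto simp: width_def intro!: Max.boundedI)
  qed
  then have "enat (width c) \<le> 4"
    by (simp add: numeral_eq_enat)
  ultimately show ?thesis
    using r by (auto simp: sfw_def intro: INF_lower2)
qed

end
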